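(* Let $\mathcal{F}$ be the family of all strictly increasing and continuous distribution functions on $\mathbf{R}$ and, for each $F\in\mathcal{F}$, let $p_F$ be the Borel probability measure on $\mathbf{R}$ defined by $F$ and let $D_F\subset\mathbf{R}^{\mathbb{N}}$ be the set of all $p_F$-equidistributed sequences on $\mathbf{R}$. Then there exists a consistent estimate of an unknown distribution function $F$ ($F\in\mathcal{F}$) for the family of Borel probability measures $\{p_F^{\mathbb{N}}:F\in\mathcal{F}\}$. Namely, fix $F_0\in\mathcal{F}$ and put $C_F=D_F$ for $F\in\mathcal{F}\setminus\{F_0\}$ and $C_{F_0}=\mathbf{R}^{\mathbb{N}}\setminus\bigcup_{F\in\mathcal{F}\setminus\{F_0\}}D_F$; then the mapping $T:\mathbf{R}^{\mathbb{N}}\to\mathcal{F}$ defined by $T((x_k)_{k\in\mathbb{N}})=F$ if $(x_k)_{k\in\mathbb{N}}\in C_F$ is such an estimate.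
   Context: $p_F^{\mathbb{N}}=p_F\times p_F\times\cdots$ is the infinite power of $p_F$, a probability measure on the Borel subsets of $\mathbf{R}^{\mathbb{N}}$ (product topology). Equidistribution: if $\mu$ is a Borel probability measure on $\mathbf{R}$ with distribution function $F$, a real sequence $(x_k)_{k\in\mathbb{N}}$ is $\mu$-equidistributed on $\mathbf{R}$ if for every interval $[a,b]$ ($-\infty\le a<b\le+\infty$) one has $\lim_{n\to\infty}n^{-1}\#([a,b]\cap\{x_1,\dots,x_n\})=F(b)-F(a)$, where $\#$ is counting measure. Consistent estimate: let $\{\mu_i:i\in I\}$ be a family of probability measures on a measurable space $(X,M)$. Let $\overline{\mu}_i$ be the usual completion of $\mu_i$, $\mathrm{dom}(\overline{\mu}_i)$ the $\sigma$-algebra of $\overline{\mu}_i$-measurable subsets of $X$, $S(X)=\bigcap_{i\in I}\mathrm{dom}(\overline{\mu}_i)$, and $L(I)$ the minimal $\sigma$-algebra on $I$ generated by all singletons of $I$. An $(S(X),L(I))$-measurable mapping $T:X\to I$ is a consistent estimate of the unknown parameter $i$ ($i\in I$) for the family $\{\mu_i:i\in I\}$ if $\overline{\mu}_i(T^{-1}(\{i\}))=1$ for every $i\in I$. *)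

theory Defs
  imports "HOL-Probability.Probability"
begin

subsection \<open>Distribution functions\<close>

definition distribution_function :: "(real \<Rightarrow> real) \<Rightarrow> bool" where
  "distribution_function F \<longleftrightarrow>
     mono F \<and> (\<forall>a. continuous (at_right a) F) \<and>
     (F \<longlongrightarrow> 0) at_bot \<and> (F \<longlongrightarrow> 1) at_top"

definition strict_cont_dfs :: "(real \<Rightarrow> real) set" where
  "strict_cont_dfs =
     {F. distribution_function F \<and> strict_mono F \<and> continuous_on UNIV F}"

lemma distribution_function_interval_measure:
  assumes "distribution_function F"
  shows "real_distribution (interval_measure F)" and "cdf (interval_measure F) = F"
  using assms
  by (auto simp: distribution_function_def mono_def
      intro!: real_distribution_interval_measure cdf_interval_measure)

text \<open>The infinite power; its \<open>\<sigma>\<close>-algebra is that of the Borel sets of the product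
  topology by \<open>sets_PiM_equal_borel\<close>.\<close>

definition df_power :: "(real \<Rightarrow> real) \<Rightarrow> (nat \<Rightarrow> real) measure" where
  "df_power F = (\<Pi>\<^sub>M k\<in>UNIV. interval_measure F)"


subsection \<open>Equidistribution\<close>

definition ext_cdf :: "real measure \<Rightarrow> ereal \<Rightarrow> real" where
  "ext_cdf \<mu> c = (if c = -\<infinity> then 0 else if c = \<infinity> then 1 else cdf \<mu> (real_of_ereal c))"

text \<open>Sequences are indexed from 0, so the first \<open>n\<close> terms are \<open>x ` {..<n}\<close>.  They are counted
  as a set: a value that occurs several times among them counts once.\<close>

definition equidistributed :: "real measure \<Rightarrow> (nat \<Rightarrow> real) \<Rightarrow> bool" where
  "equidistributed \<mu> x \<longleftrightarrow>
     (\<forall>a b :: ereal. a < b \<longrightarrow>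
        (\<lambda>n. real (card ({t. a \<le> ereal t \<and> ereal t \<le> b} \<inter> x ` {..<n})) / real n)
          \<longlonglongrightarrow> ext_cdf \<mu> b - ext_cdf \<mu> a)"

definition D :: "(real \<Rightarrow> real) \<Rightarrow> (nat \<Rightarrow> real) set" where
  "D F = {x. equidistributed (interval_measure F) x}"


subsection \<open>Consistent estimates\<close>

definition completion_sets :: "'x measure \<Rightarrow> 'i set \<Rightarrow> ('i \<Rightarrow> 'x measure) \<Rightarrow> 'x set set" where
  "completion_sets M I \<mu> = {A. A \<subseteq> space M \<and> (\<forall>i\<in>I. A \<in> sets (completion (\<mu> i)))}"

definition consistent_estimate ::
    "'x measure \<Rightarrow> 'i set \<Rightarrow> ('i \<Rightarrow> 'x measure) \<Rightarrow> ('x \<Rightarrow> 'i) \<Rightarrow> bool" where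
  "consistent_estimate M I \<mu> T \<longleftrightarrow>
     (\<forall>i\<in>I. prob_space (\<mu> i) \<and> sets (\<mu> i) = sets M) \<and>
     T \<in> measurable (sigma (space M) (completion_sets M I \<mu>)) (sigma I {{i} |i. i \<in> I}) \<and>
     (\<forall>i\<in>I. emeasure (completion (\<mu> i)) (T -` {i} \<inter> space M) = 1)"

text \<open>The completion sets already form a \<open>\<sigma>\<close>-algebra, so \<open>sigma\<close> above adds nothing to them.\<close>

lemma sets_sigma_completion_sets:
  assumes "\<And>i. i \<in> I \<Longrightarrow> sets (\<mu> i) = sets M"
  shows "sets (sigma (space M) (completion_sets M I \<mu>)) = completion_sets M I \<mu>"
proof -
  have sp: "space (\<mu> i) = space M" if "i \<in> I" for i
    using assms[OF that] by (rule sets_eq_imp_space_eq)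
  have "sigma_algebra (space M) (completion_sets M I \<mu>)"
  proof (rule sigma_algebra_iff2[THEN iffD2], intro conjI ballI allI impI)
    fix A assume A: "A \<in> completion_sets M I \<mu>"
    have "space M - A \<in> sets (completion (\<mu> i))" if "i \<in> I" for i
      using A that sets.compl_sets[of A "completion (\<mu> i)"] sp[OF that]
      by (auto simp: completion_sets_def)
    then show "space M - A \<in> completion_sets M I \<mu>"
      by (auto simp: completion_sets_def)
  qed (auto simp: completion_sets_def intro!: sets.countable_UN)
  then show ?thesis
    by (simp add: sigma_algebra.sets_measure_of_eq)
qed


subsection \<open>The sets \<open>C\<close> and the estimate\<close>

definition C :: "(real \<Rightarrow> real) \<Rightarrow> (real \<Rightarrow> real) \<Rightarrow> (nat \<Rightarrow> real) set" where
  "C F0 F = (if F = F0 then UNIV - (\<Union>G\<in>strict_cont_dfs - {F0}. D G) else D F)"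

definition T_est :: "(real \<Rightarrow> real) \<Rightarrow> (nat \<Rightarrow> real) \<Rightarrow> (real \<Rightarrow> real)" where
  "T_est F0 x = (THE F. F \<in> strict_cont_dfs \<and> x \<in> C F0 F)"

end

theory Submission
  imports Defs "HOL-Real_Asymp.Real_Asymp"
begin

text \<open>
  Under \<open>df_power F\<close> the coordinates are independent with distribution function \<open>F\<close>, so almost
  every sequence is equidistributed for \<open>F\<close> (\<open>AE_D\<close>).  By the strong law, the proportion of the
  first \<open>n\<close> terms that are \<open>\<le> q\<close> converges to \<open>F q\<close>, for all rational \<open>q\<close> simultaneously; since
  counting functions are monotone and \<open>F\<close> is continuous, the convergence extends to every real
  argument (\<open>empirical_cdf_tendsto_of_rational\<close>).  Equidistribution counts the \<^emph>\<open>values\<close> among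
  the first \<open>n\<close> terms rather than the indices.  The two counts agree because \<open>F\<close> has no atoms:
  almost surely all terms are distinct (\<open>AE_neq_of_indep_vars\<close>), and distinctness also
  makes a closed endpoint contribute at most one term (\<open>equidistributedI\<close>).

  Conversely a sequence determines the law for which it is equidistributed, through the rays
  \<open>[-\<infinity>, t]\<close>; hence the sets \<open>D F\<close> are pairwise disjoint and the sets \<open>C F0 F\<close>, which enlarge one
  of them to absorb all remaining sequences, partition the space of sequences.

  The sets \<open>C F0 F\<close> are measurable for every completed power for a soft reason: for each
  \<open>G\<close>, the cell \<open>C F0 G\<close> has full measure under \<open>df_power G\<close>, so every other cell is null.  Thus
  each cell is null or co-null for each of the completed measures, whatever its Borel
  complexity (\<open>C_in_sets_completion\<close>).  Since the cells are the fibres of the estimate,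
  consistency follows.
\<close>

section \<open>Independent random variables\<close>

text \<open>For bounded variables Hoeffding's inequality bounds the probability of a deviation by \<open>\<epsilon>\<close>
  geometrically in \<open>n\<close>, so that the Borel--Cantelli lemma gives almost sure convergence directly.\<close>

lemma (in prob_space) strong_law_bounded:
  fixes X :: "nat \<Rightarrow> 'a \<Rightarrow> real"
  assumes indep: "indep_vars (\<lambda>_. borel) X UNIV"
    and bounded: "\<And>i. AE x in M. X i x \<in> {a..b}"
    and mean: "\<And>i. expectation (X i) = m"
    and ab: "a < b"
  shows "AE x in M. (\<lambda>n. (\<Sum>i<n. X i x) / real n) \<longlonglongrightarrow> m"
proof -
  have [measurable]: "random_variable borel (X i)" for i
    using indep unfolding indep_vars_def by blast
  define A where "A = (\<lambda>k n. {x \<in> space M.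
    \<bar>(\<Sum>i<n. X i x) - real n * m\<bar> \<ge> real n / real (Suc k)})"
  have A_meas [measurable]: "A k n \<in> sets M" for k n
    unfolding A_def by measurable
  have "AE x in M. \<forall>\<^sub>F n in sequentially. x \<in> space M - A k n" for k
  proof (rule borel_cantelli_AE1)
    define c where "c = 2 * (1 / real (Suc k))\<^sup>2 / (b - a)\<^sup>2"
    have c: "c > 0" using ab by (simp add: c_def)
    have bound: "prob (A k n) \<le> 2 * exp (- c) ^ n" for n
    proof (cases "n = 0")
      case True
      then show ?thesis by (simp add: order_trans[OF prob_le_1])
    next
      case False
      interpret Hoeffding_ineq M "{..<n}" X "\<lambda>_. a" "\<lambda>_. b" "real n * m"
      proof unfold_locales
        show "indep_vars (\<lambda>_. borel) X {..<n}"
          using indep by (rule indep_vars_subset) simp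
        show "AE x in M. X i x \<in> {a..b}" for i by (rule bounded)
      qed (simp_all add: mean)
      have "prob (A k n) \<le> 2 * exp (- 2 * (real n / real (Suc k))\<^sup>2 / (\<Sum>i<n. (b - a)\<^sup>2))"
        unfolding A_def using False ab by (intro Hoeffding_ineq_abs_ge) auto
      also have "- 2 * (real n / real (Suc k))\<^sup>2 / (\<Sum>i<n. (b - a)\<^sup>2) = real n * (- c)"
        using False by (simp add: c_def power_divide power2_eq_square[of "real n"])
      finally show ?thesis by (simp only: exp_of_nat_mult)
    qed
    have "summable (\<lambda>n. 2 * exp (- c) ^ n)"
      using c by (intro summable_mult summable_geometric) simp
    then show "summable (\<lambda>n. prob (A k n))"
    proof (rule summable_comparison_test')
      show "norm (prob (A k n)) \<le> 2 * exp (- c) ^ n" for n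
        using bound[of n] by simp
    qed
    show "A k n \<in> sets M" "emeasure M (A k n) < \<infinity>" for n
      by (rule A_meas, simp add: emeasure_eq_measure)
  qed
  then have "AE x in M. \<forall>k. \<forall>\<^sub>F n in sequentially. x \<in> space M - A k n"
    unfolding AE_all_countable by (rule allI)
  then show ?thesis
  proof (rule eventually_mono)
    fix x assume x: "\<forall>k. \<forall>\<^sub>F n in sequentially. x \<in> space M - A k n"
    define S where "S = (\<lambda>n. \<Sum>i<n. X i x)"
    have "(\<lambda>n. S n / real n) \<longlonglongrightarrow> m"
    proof (rule tendstoI)
      fix e :: real assume "e > 0"
      then obtain k where k: "1 / real (Suc k) < e"
        using nat_approx_posE by blast
      from spec[OF x, of k] eventually_gt_at_top[of 0]
      show "\<forall>\<^sub>F n in sequentially. dist (S n / real n) m < e"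
      proof (rule eventually_elim2)
        fix n :: nat assume n: "x \<in> space M - A k n" "0 < n"
        have "\<bar>S n - real n * m\<bar> < real n * (1 / real (Suc k))"
          using n(1) unfolding A_def S_def by (auto simp: not_le)
        also have "\<dots> \<le> real n * e"
          using k by (intro mult_left_mono) auto
        finally have "\<bar>S n - real n * m\<bar> / real n < e"
          using n(2) by (simp add: pos_divide_less_eq mult.commute)
        moreover have "S n / real n - m = (S n - real n * m) / real n"
          using n(2) by (simp add: diff_divide_distrib)
        ultimately show "dist (S n / real n) m < e"
          by (simp add: dist_real_def)
      qed
    qed
    then show "(\<lambda>n. (\<Sum>i<n. X i x) / real n) \<longlonglongrightarrow> m"
      by (simp only: S_def)
  qed
qed

text \<open>By independence the joint law of two variables is a product measure, and by Fubini the diagonal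
  is null for a product with an atomless factor.\<close>

lemma (in prob_space) AE_neq_of_indep_vars:
  fixes X :: "'i \<Rightarrow> 'a \<Rightarrow> real"
  assumes indep: "indep_vars (\<lambda>_. borel) X UNIV"
    and no_atoms: "\<And>t. AE y in distr M borel (X j). y \<noteq> t"
    and "i \<noteq> j"
  shows "AE x in M. X i x \<noteq> X j x"
proof -
  have [measurable]: "random_variable borel (X i)" for i
    using indep unfolding indep_vars_def by blast
  have "indep_var borel ((\<lambda>f. f i) \<circ> (\<lambda>x. restrict (\<lambda>i. X i x) {i}))
                  borel ((\<lambda>f. f j) \<circ> (\<lambda>x. restrict (\<lambda>i. X i x) {j}))"
    using \<open>i \<noteq> j\<close>
    by (intro indep_var_compose[OF indep_var_restrict[OF indep]] measurable_component_singleton) auto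
  then have joint: "distr M borel (X i) \<Otimes>\<^sub>M distr M borel (X j) =
      distr M (borel \<Otimes>\<^sub>M borel) (\<lambda>x. (X i x, X j x))"
    by (simp add: indep_var_distribution_eq comp_def)
  interpret Xi: prob_space "distr M borel (X i)" by (rule prob_space_distr) simp
  interpret Xj: prob_space "distr M borel (X j)" by (rule prob_space_distr) simp
  interpret pair_prob_space "distr M borel (X i)" "distr M borel (X j)" ..
  have "AE p in distr M borel (X i) \<Otimes>\<^sub>M distr M borel (X j). fst p \<noteq> snd p"
  proof (rule AE_pair_measure)
    show "AE x in distr M borel (X i). AE y in distr M borel (X j). fst (x, y) \<noteq> snd (x, y)"
    proof (rule AE_I2)
      fix x
      show "AE y in distr M borel (X j). fst (x, y) \<noteq> snd (x, y)"
        using no_atoms[of x] by eventually_elim simp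
    qed
  qed measurable
  then show ?thesis
    unfolding joint by (subst (asm) AE_distr_iff) auto
qed

lemma (in prob_space) indep_vars_PiM_coordinates:
  "prob_space.indep_vars (PiM UNIV (\<lambda>_ :: 'i. M)) (\<lambda>_. M) (\<lambda>i \<omega>. \<omega> i) UNIV"
proof -
  interpret P: product_prob_space "\<lambda>_ :: 'i. M" UNIV ..
  have "distr (PiM UNIV (\<lambda>_. M)) M (\<lambda>\<omega>. \<omega> i) = M" for i :: 'i
    by (rule P.PiM_component) simp
  then have "distr (PiM UNIV (\<lambda>_. M)) (PiM UNIV (\<lambda>_. M)) (\<lambda>\<omega>. \<lambda>i\<in>UNIV. \<omega> i) =
        (\<Pi>\<^sub>M i\<in>(UNIV :: 'i set). distr (PiM UNIV (\<lambda>_. M)) M (\<lambda>\<omega>. \<omega> i))"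
    by (simp only: restrict_UNIV distr_id)
  then show ?thesis
    by (intro P.indep_vars_iff_distr_eq_PiM'[THEN iffD2]) (simp, rule measurable_component_singleton, simp)
qed


section \<open>Empirical distribution functions and equidistribution\<close>

text \<open>Counting indices, in contrast to \<open>equidistributed\<close>, makes this the average of the indicators
  of the events \<open>x k \<le> c\<close>.  The argument is extended so that one
  counting identity serves intervals with finite and with infinite endpoints.\<close>

definition empirical_cdf :: "(nat \<Rightarrow> real) \<Rightarrow> nat \<Rightarrow> ereal \<Rightarrow> real" where
  "empirical_cdf x n c = real (card {k \<in> {..<n}. ereal (x k) \<le> c}) / real n"

lemma empirical_cdf_mono: "c \<le> d \<Longrightarrow> empirical_cdf x n c \<le> empirical_cdf x n d"
  unfolding empirical_cdf_def
  by (intro divide_right_mono of_nat_mono card_mono) auto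

text \<open>A monotone function is squeezed between its values at nearby rationals; continuity of the limit
  closes the gap.  This reduces an uncountable family of almost sure statements to a countable one.\<close>

lemma empirical_cdf_tendsto_of_rational:
  fixes F :: "real \<Rightarrow> real"
  assumes cont: "isCont F t"
    and rat: "\<And>q. q \<in> \<rat> \<Longrightarrow> (\<lambda>n. empirical_cdf x n (ereal q)) \<longlonglongrightarrow> F q"
  shows "(\<lambda>n. empirical_cdf x n (ereal t)) \<longlonglongrightarrow> F t"
proof (rule order_tendstoI)
  fix y assume y: "y < F t"
  then have "\<forall>\<^sub>F s in at_left t. y < F s"
    using cont by (intro order_tendstoD) (auto simp: isCont_def filterlim_at_split)
  then obtain b where b: "b < t" "\<And>s. b < s \<Longrightarrow> s < t \<Longrightarrow> y < F s"
    by (auto simp: eventually_at_left_field)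
  obtain q where q: "q \<in> \<rat>" "b < q" "q < t" using Rats_dense_in_real[OF b(1)] by blast
  from order_tendstoD(1)[OF rat[OF q(1)] b(2)[OF q(2,3)]]
  show "\<forall>\<^sub>F n in sequentially. y < empirical_cdf x n (ereal t)"
    by eventually_elim (use q(3) empirical_cdf_mono[of "ereal q" "ereal t" x] in \<open>auto intro: less_le_trans\<close>)
next
  fix y assume y: "F t < y"
  then have "\<forall>\<^sub>F s in at_right t. F s < y"
    using cont by (intro order_tendstoD) (auto simp: isCont_def filterlim_at_split)
  then obtain b where b: "t < b" "\<And>s. t < s \<Longrightarrow> s < b \<Longrightarrow> F s < y"
    by (auto simp: eventually_at_right_field)
  obtain q where q: "q \<in> \<rat>" "t < q" "q < b" using Rats_dense_in_real[OF b(1)] by blast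
  from order_tendstoD(2)[OF rat[OF q(1)] b(2)[OF q(2,3)]]
  show "\<forall>\<^sub>F n in sequentially. empirical_cdf x n (ereal t) < y"
    by eventually_elim (use q(2) empirical_cdf_mono[of "ereal t" "ereal q" x] in \<open>auto intro: le_less_trans\<close>)
qed

text \<open>Injectivity is used twice: it turns the number of values in an interval into a number of
  indices, and it bounds by \<open>1\<close> the number of indices with \<open>x k = a\<close>, which is the error made in
  writing the count for \<open>[a, b]\<close> as a difference of counts for rays.\<close>

lemma equidistributedI:
  assumes inj: "inj x"
    and lim: "\<And>t. (\<lambda>n. empirical_cdf x n (ereal t)) \<longlonglongrightarrow> cdf \<mu> t"
  shows "equidistributed \<mu> x"
  unfolding equidistributed_def
proof (intro allI impI)
  fix a b :: ereal assume "a < b"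
  have ext_lim: "(\<lambda>n. empirical_cdf x n c) \<longlonglongrightarrow> ext_cdf \<mu> c" for c
  proof (cases c)
    case (real t)
    then show ?thesis using lim[of t] by (simp add: ext_cdf_def)
  next
    case PInf
    have "\<forall>\<^sub>F n in sequentially. 1 = empirical_cdf x n c"
      using eventually_gt_at_top[of 0]
      by eventually_elim (simp add: PInf empirical_cdf_def lessThan_def)
    then show ?thesis using PInf
      by (auto simp: ext_cdf_def intro: Lim_transform_eventually[OF tendsto_const])
  next
    case MInf
    then show ?thesis by (simp add: ext_cdf_def empirical_cdf_def)
  qed
  have count_Icc: "real (card ({t. a \<le> ereal t \<and> ereal t \<le> b} \<inter> x ` {..<n})) / real n =
      empirical_cdf x n b - empirical_cdf x n a + card {k \<in> {..<n}. ereal (x k) = a} / real n"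
    for n
  proof -
    have "{t. a \<le> ereal t \<and> ereal t \<le> b} \<inter> x ` {..<n} =
        x ` {k \<in> {..<n}. a \<le> ereal (x k) \<and> ereal (x k) \<le> b}"
      by auto
    then have "card ({t. a \<le> ereal t \<and> ereal t \<le> b} \<inter> x ` {..<n}) =
        card {k \<in> {..<n}. a \<le> ereal (x k) \<and> ereal (x k) \<le> b}"
      by (simp add: card_image inj_on_subset[OF inj])
    moreover have "card {k \<in> {..<n}. ereal (x k) \<le> b} + card {k \<in> {..<n}. ereal (x k) = a} =
        card {k \<in> {..<n}. a \<le> ereal (x k) \<and> ereal (x k) \<le> b} +
        card {k \<in> {..<n}. ereal (x k) \<le> a}"
    proof -
      have "card {k \<in> {..<n}. ereal (x k) \<le> b} =
          card ({k \<in> {..<n}. a \<le> ereal (x k) \<and> ereal (x k) \<le> b} \<union>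
                {k \<in> {..<n}. ereal (x k) < a})"
        using \<open>a < b\<close> by (intro arg_cong[where f = card]) auto
      also have "\<dots> = card {k \<in> {..<n}. a \<le> ereal (x k) \<and> ereal (x k) \<le> b} +
          card {k \<in> {..<n}. ereal (x k) < a}"
        by (intro card_Un_disjoint) auto
      finally have 1: "card {k \<in> {..<n}. ereal (x k) \<le> b} = \<dots>" .
      have "card {k \<in> {..<n}. ereal (x k) \<le> a} =
          card ({k \<in> {..<n}. ereal (x k) < a} \<union> {k \<in> {..<n}. ereal (x k) = a})"
        by (intro arg_cong[where f = card]) auto
      also have "\<dots> = card {k \<in> {..<n}. ereal (x k) < a} + card {k \<in> {..<n}. ereal (x k) = a}"
        by (intro card_Un_disjoint) auto
      finally show ?thesis using 1 by simp
    qed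
    ultimately have "real (card ({t. a \<le> ereal t \<and> ereal t \<le> b} \<inter> x ` {..<n})) =
        card {k \<in> {..<n}. ereal (x k) \<le> b} - real (card {k \<in> {..<n}. ereal (x k) \<le> a}) +
        card {k \<in> {..<n}. ereal (x k) = a}"
      by linarith
    then show ?thesis
      by (simp add: empirical_cdf_def add_divide_distrib diff_divide_distrib)
  qed
  have "card {k \<in> {..<n}. ereal (x k) = a} \<le> 1" for n
    using inj by (auto simp: card_le_Suc0_iff_eq inj_def)
  then have "(\<lambda>n. card {k \<in> {..<n}. ereal (x k) = a} / real n) \<longlonglongrightarrow> 0"
    by (intro tendsto_sandwich[OF _ _ tendsto_const lim_1_over_n])
       (auto intro!: always_eventually divide_right_mono)
  then have "(\<lambda>n. empirical_cdf x n b - empirical_cdf x n a +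
      card {k \<in> {..<n}. ereal (x k) = a} / real n) \<longlonglongrightarrow> ext_cdf \<mu> b - ext_cdf \<mu> a + 0"
    by (intro tendsto_intros ext_lim)
  then show "(\<lambda>n. real (card ({t. a \<le> ereal t \<and> ereal t \<le> b} \<inter> x ` {..<n})) / real n)
      \<longlonglongrightarrow> ext_cdf \<mu> b - ext_cdf \<mu> a"
    by (simp add: count_Icc)
qed

lemma equidistributed_cdf_unique:
  assumes "equidistributed \<mu> x" "equidistributed \<nu> x"
  shows "cdf \<mu> = cdf \<nu>"
proof
  fix t
  have "- \<infinity> < ereal t" by simp
  with assms have "ext_cdf \<mu> (ereal t) - ext_cdf \<mu> (- \<infinity>) = ext_cdf \<nu> (ereal t) - ext_cdf \<nu> (- \<infinity>)"
    unfolding equidistributed_def by (blast intro: LIMSEQ_unique)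
  then show "cdf \<mu> t = cdf \<nu> t" by (simp add: ext_cdf_def)
qed

section \<open>Almost every sequence is equidistributed\<close>

lemma (in prob_space) AE_equidistributed:
  fixes X :: "nat \<Rightarrow> 'a \<Rightarrow> real"
  assumes indep: "indep_vars (\<lambda>_. borel) X UNIV"
    and law: "\<And>i. distr M borel (X i) = \<mu>"
    and cont: "\<And>t. isCont (cdf \<mu>) t"
  shows "AE \<omega> in M. equidistributed \<mu> (\<lambda>i. X i \<omega>)"
proof -
  have [measurable]: "random_variable borel (X i)" for i
    using indep unfolding indep_vars_def by blast
  interpret \<mu>: real_distribution \<mu>
    unfolding law[of 0, symmetric] by (rule real_distribution_distr) simp
  have no_atoms: "AE y in \<mu>. y \<noteq> t" for t
    using cont[of t]
    by (intro AE_I[of _ _ "{t}"]) (auto simp: \<mu>.isCont_cdf \<mu>.emeasure_eq_measure)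
  have "AE \<omega> in M. \<forall>i j. i \<noteq> j \<longrightarrow> X i \<omega> \<noteq> X j \<omega>"
    unfolding AE_all_countable
    by (intro allI AE_impI AE_neq_of_indep_vars[OF indep]) (auto simp only: law no_atoms)
  then have inj: "AE \<omega> in M. inj (\<lambda>i. X i \<omega>)"
    by eventually_elim (auto simp: inj_def)
  have "AE \<omega> in M. (\<lambda>n. empirical_cdf (\<lambda>i. X i \<omega>) n (ereal t)) \<longlonglongrightarrow> cdf \<mu> t" for t
  proof -
    have "expectation (\<lambda>\<omega>. indicator {..t} (X i \<omega>) :: real) = cdf \<mu> t" for i
    proof -
      have "expectation (\<lambda>\<omega>. indicator {..t} (X i \<omega>) :: real) =
          (\<integral>y. indicator {..t} y \<partial>distr M borel (X i))"
        by (rule integral_distr[symmetric]) auto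
      then show ?thesis by (simp add: law cdf_def)
    qed
    then have "AE \<omega> in M. (\<lambda>n. (\<Sum>i<n. indicator {..t} (X i \<omega>)) / real n) \<longlonglongrightarrow> cdf \<mu> t"
      by (intro strong_law_bounded[where a = 0 and b = 1] indep_vars_compose2[OF indep])
         (auto simp: indicator_def)
    then show ?thesis
      by (simp add: empirical_cdf_def indicator_def sum.If_cases Int_def flip: sum.inter_filter)
  qed
  then have "AE \<omega> in M. \<forall>q\<in>\<rat>. (\<lambda>n. empirical_cdf (\<lambda>i. X i \<omega>) n (ereal q)) \<longlonglongrightarrow> cdf \<mu> q"
    by (intro AE_ball_countable[THEN iffD2] countable_rat) auto
  with inj show ?thesis
    by eventually_elim
       (rule equidistributedI, simp, rule empirical_cdf_tendsto_of_rational[OF cont], simp)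
qed

section \<open>The estimate\<close>

lemma strict_cont_dfsD:
  assumes "F \<in> strict_cont_dfs"
  shows "real_distribution (interval_measure F)" "cdf (interval_measure F) = F" "isCont F t"
  using assms distribution_function_interval_measure[of F]
  by (auto simp: strict_cont_dfs_def continuous_on_eq_continuous_at)

lemma prob_space_df_power: "F \<in> strict_cont_dfs \<Longrightarrow> prob_space (df_power F)"
  unfolding df_power_def
  by (intro prob_space_PiM real_distribution.axioms(1) strict_cont_dfsD)

lemma sets_df_power: "sets (df_power F) = sets borel"
  unfolding df_power_def sets_PiM_equal_borel[symmetric]
  by (intro sets_PiM_cong) auto

lemma space_df_power: "space (df_power F) = UNIV"
  using sets_eq_imp_space_eq[OF sets_df_power] by simp

lemma AE_D:
  assumes F: "F \<in> strict_cont_dfs"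
  shows "AE x in df_power F. x \<in> D F"
proof -
  interpret F: real_distribution "interval_measure F" by (rule strict_cont_dfsD[OF F])
  interpret P: product_prob_space "\<lambda>_ :: nat. interval_measure F" UNIV ..
  have "P.indep_vars (\<lambda>_. borel) (\<lambda>i x. x i) UNIV"
    using F.indep_vars_PiM_coordinates[where 'i = nat]
    by (simp add: P.indep_vars_def2)
  moreover have "distr (PiM UNIV (\<lambda>_. interval_measure F)) borel (\<lambda>x. x i) = interval_measure F"
    for i :: nat
    using P.PiM_component[of i] by (simp cong: distr_cong)
  ultimately have "AE x in PiM UNIV (\<lambda>_. interval_measure F). equidistributed (interval_measure F) (\<lambda>i. x i)"
    using strict_cont_dfsD[OF F] by (intro P.AE_equidistributed) auto
  then show ?thesis unfolding df_power_def D_def by simp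
qed

lemma D_disjoint:
  assumes "F \<in> strict_cont_dfs" "G \<in> strict_cont_dfs" "x \<in> D F" "x \<in> D G"
  shows "F = G"
  using assms equidistributed_cdf_unique[of "interval_measure F" x "interval_measure G"]
  by (simp add: D_def strict_cont_dfsD)

lemma D_subset_C: "F0 \<in> strict_cont_dfs \<Longrightarrow> F \<in> strict_cont_dfs \<Longrightarrow> D F \<subseteq> C F0 F"
  by (auto simp: C_def dest: D_disjoint)

lemma C_partition:
  assumes "F0 \<in> strict_cont_dfs"
  shows "\<exists>!F. F \<in> strict_cont_dfs \<and> x \<in> C F0 F"
proof (cases "\<exists>G \<in> strict_cont_dfs - {F0}. x \<in> D G")
  case True
  then show ?thesis by (auto simp: C_def split: if_splits intro: D_disjoint)
next
  case False
  with assms show ?thesis by (intro ex1I[of _ F0]) (auto simp: C_def split: if_splits)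
qed

lemma T_est_eq_iff:
  assumes "F0 \<in> strict_cont_dfs" "F \<in> strict_cont_dfs"
  shows "T_est F0 x = F \<longleftrightarrow> x \<in> C F0 F"
  using theI'[OF C_partition[OF assms(1), of x]] C_partition[OF assms(1), of x] assms(2)
  unfolding T_est_def by blast

lemma T_est_in: "F0 \<in> strict_cont_dfs \<Longrightarrow> T_est F0 x \<in> strict_cont_dfs"
  using theI'[OF C_partition, of F0 x] unfolding T_est_def by blast

text \<open>Up to a null set of \<open>df_power G\<close>, the set \<open>C F0 F\<close> is everything if \<open>F = G\<close> and empty otherwise,
  because \<open>C F0 G\<close> has full measure and the cells are disjoint.  Completeness does the rest.\<close>

lemma C_in_sets_completion:
  assumes "F0 \<in> strict_cont_dfs" "F \<in> strict_cont_dfs" "G \<in> strict_cont_dfs"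
  shows "C F0 F \<in> sets (completion (df_power G))"
proof -
  have "AE x in completion (df_power G). x \<in> C F0 G"
    using AE_D[OF assms(3)] D_subset_C[OF assms(1,3)]
    by (intro AE_completion) (auto elim: eventually_mono)
  then have "AE x in completion (df_power G). x \<in> (if F = G then UNIV else {}) \<longleftrightarrow> x \<in> C F0 F"
    by eventually_elim (use assms C_partition[OF assms(1)] in \<open>auto; blast\<close>)
  moreover have "(if F = G then UNIV else {}) \<in> sets (completion (df_power G))"
    using sets.top[of "completion (df_power G)"] by (simp add: space_df_power)
  ultimately show ?thesis
    by (rule completion.in_sets_AE) (simp_all add: space_df_power)
qed

lemma T_est_consistent:
  assumes F0: "F0 \<in> strict_cont_dfs"
  shows "consistent_estimate borel strict_cont_dfs df_power (T_est F0)"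
proof -
  have vimage: "T_est F0 -` {F} = C F0 F" if "F \<in> strict_cont_dfs" for F
    using T_est_eq_iff[OF F0 that] by auto
  have "T_est F0 \<in> measurable (sigma (space borel) (completion_sets borel strict_cont_dfs df_power))
      (sigma strict_cont_dfs {{i} |i. i \<in> strict_cont_dfs})"
  proof (rule measurable_measure_of)
    fix A assume "A \<in> {{i} |i. i \<in> strict_cont_dfs}"
    then obtain F where "A = {F}" and F: "F \<in> strict_cont_dfs" by blast
    then show "T_est F0 -` A \<inter> space (sigma (space borel) (completion_sets borel strict_cont_dfs df_power))
        \<in> sets (sigma (space borel) (completion_sets borel strict_cont_dfs df_power))"
      using vimage[OF F] C_in_sets_completion[OF F0 F]
      by (subst sets_sigma_completion_sets)
         (auto simp: sets_df_power completion_sets_def space_measure_of_conv)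
  qed (auto simp: T_est_in[OF F0] space_measure_of_conv)
  moreover have "emeasure (completion (df_power F)) (T_est F0 -` {F} \<inter> space borel) = 1"
    if F: "F \<in> strict_cont_dfs" for F
  proof -
    interpret prob_space "completion (df_power F)"
      by (intro prob_space.prob_space_completion prob_space_df_power F)
    have "AE x in completion (df_power F). x \<in> C F0 F"
      using AE_D[OF F] D_subset_C[OF F0 F]
      by (intro AE_completion) (auto elim: eventually_mono)
    then show ?thesis
      using emeasure_eq_1_AE[OF C_in_sets_completion[OF F0 F F]]
      unfolding vimage[OF F] space_borel Int_UNIV_right by simp
  qed
  ultimately show ?thesis
    by (simp add: consistent_estimate_def prob_space_df_power sets_df_power)
qed

text \<open>The family is nonempty, so that there is an \<open>F0\<close> from which to build an estimate.\<close>

lemma logistic_in_strict_cont_dfs: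
  "(\<lambda>t::real. 1 / (1 + exp (- t))) \<in> strict_cont_dfs"
proof -
  let ?L = "\<lambda>t::real. 1 / (1 + exp (- t))"
  have pos: "1 + exp (- t) \<noteq> 0" for t :: real
    by (metis add_pos_pos exp_gt_zero less_irrefl zero_less_one)
  have sm: "strict_mono ?L"
    by (auto simp: strict_mono_def add_pos_pos intro!: divide_strict_left_mono)
  have cont: "continuous_on UNIV ?L"
    using pos by (intro continuous_intros) auto
  then have "continuous (at_right a) ?L" for a
    by (auto simp: continuous_on_eq_continuous_at intro: continuous_at_imp_continuous_at_within)
  moreover have "(?L \<longlongrightarrow> 0) at_bot" "(?L \<longlongrightarrow> 1) at_top"
    by real_asymp+
  ultimately show ?thesis
    using sm cont by (auto simp: strict_cont_dfs_def distribution_function_def strict_mono_mono)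
qed

theorem mainTheorem3:
  shows "(\<exists>T. consistent_estimate (borel :: (nat \<Rightarrow> real) measure) strict_cont_dfs df_power T) \<and>
    (\<forall>F0\<in>strict_cont_dfs.
       (\<forall>x. \<exists>!F. F \<in> strict_cont_dfs \<and> x \<in> C F0 F) \<and>
       consistent_estimate (borel :: (nat \<Rightarrow> real) measure) strict_cont_dfs df_power (T_est F0))"
  using logistic_in_strict_cont_dfs C_partition T_est_consistent by blast

end
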